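(* Let $E$ be a real Banach space and $\Phi=I_0-I$, where $I\in C^1(E,\mathbb{R})$ and $I_0:E\to\mathbb{R}$ is a locally Lipschitz convex functional. Suppose that: - (i) there exist $\rho>0$ and $\alpha>\Phi(0)$ such that $\Phi|_{\partial B_\rho(0)}\ge\alpha$; - (ii) $\Phi(e)<\Phi(0)$ for some $e\in E\setminus\overline{B_\rho(0)}$. Let $$c=\inf_{\gamma\in\Gamma}\ \sup_{t\in[0,1]}\Phi(\gamma(t)),\qquad \Gamma=\{\gamma\in C^0([0,1],E):\ \gamma(0)=0,\ \gamma(1)=e\}.$$ Then $c\ge\alpha$, and for every $\epsilon>0$ there exists $x_\epsilon\in E$ such that $$c-\epsilon<\Phi(x_\epsilon)<c+\epsilon$$ and $$I_0(y)-I_0(x_\epsilon)\ \ge\ I'(x_\epsilon)(y-x_\epsilon)-\epsilon\|y-x_\epsilon\|\qquad\text{for all }y\in E.$$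
   Context: $B_\rho(0)$ is the open ball of radius $\rho$ centered at $0$ in $E$, $\partial B_\rho(0)$ its boundary, and $I'(x)\in E^*$ the Fréchet derivative of $I$ at $x$. *)

theory Defs
  imports "HOL-Analysis.Analysis"
begin

definition locally_lipschitz :: "('a::metric_space \<Rightarrow> 'b::metric_space) \<Rightarrow> bool" where
  "locally_lipschitz f \<longleftrightarrow> (\<forall>x. \<exists>r>0. \<exists>L. L-lipschitz_on (ball x r) f)"

text \<open>The dual space of \<open>'a\<close> is the type \<open>'a \<Rightarrow>\<^sub>L real\<close> with the operator norm, so the
  second conjunct is continuity of the derivative with respect to the dual norm.\<close>

definition C1_with_derivative ::
    "('a::real_normed_vector \<Rightarrow> real) \<Rightarrow> ('a \<Rightarrow> ('a \<Rightarrow>\<^sub>L real)) \<Rightarrow> bool" where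
  "C1_with_derivative f f' \<longleftrightarrow>
     (\<forall>x. (f has_derivative blinfun_apply (f' x)) (at x)) \<and> continuous_on UNIV f'"

text \<open>Paths are total functions on the reals; values outside \<open>{0..1}\<close> are irrelevant.\<close>

definition paths_to :: "'a::real_normed_vector \<Rightarrow> (real \<Rightarrow> 'a) set" where
  "paths_to e = {\<gamma>. continuous_on {0..1} \<gamma> \<and> \<gamma> 0 = 0 \<and> \<gamma> 1 = e}"

text \<open>Infimum and supremum are those of the reals, which are meaningful only for nonempty bounded
  sets. This is the case for continuous \<open>\<Phi>\<close>: the suprema are over compact intervals, the
  segment from \<open>0\<close> to \<open>e\<close> is an admissible path, and all suprema are at least \<open>\<Phi> 0\<close>.\<close>

definition minimax_level :: "('a::real_normed_vector \<Rightarrow> real) \<Rightarrow> 'a \<Rightarrow> real" where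
  "minimax_level \<Phi> e = (INF \<gamma>\<in>paths_to e. SUP t\<in>{0..1}. \<Phi> (\<gamma> t))"

end

theory Submission
  imports Defs
begin

text \<open>Ekeland's principle on the complete space of paths yields, for \<open>\<epsilon> > 0\<close>, a path \<open>\<gamma>\<close> of height
  \<open>M < c + \<epsilon>\<close> such that every path \<open>\<eta>\<close> has height at least \<open>M - \<epsilon>/2 \<cdot> dist \<gamma> \<eta>\<close>. If no peak of
  \<open>\<gamma>\<close> were an \<open>\<epsilon>\<close>-critical point, each peak would have a direction of norm at most 1 along which
  some difference quotient of \<open>I0\<close> is less than the derivative of \<open>I\<close> minus \<open>\<epsilon>\<close>. For fixed \<open>t\<close> these
  directions form a convex set, and a direction stays admissible for nearby \<open>t\<close>, so a partition of
  unity turns them into a continuous field \<open>h\<close> vanishing at the endpoints. The peaks of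
  \<open>\<gamma> + r h\<close> accumulate, as \<open>r\<close> tends to 0, at a peak of \<open>\<gamma>\<close> where every difference quotient of \<open>I0\<close>
  along \<open>h\<close> is at least the derivative of \<open>I\<close> minus \<open>\<epsilon>/2\<close>, a contradiction.\<close>


section \<open>Ekeland's variational principle\<close>

text \<open>A greedy sequence, each term nearly minimising \<open>J\<close> over the points below
  its predecessor in the order behind \<open>S\<close>, converges to a minimal point. Lower
  semicontinuity enters as closedness of the sublevel sets in the whole space, which also keeps the
  limit in \<open>X\<close>.\<close>

theorem ekeland_variational_principle:
  fixes J :: "'b::complete_space \<Rightarrow> real"
  assumes "x0 \<in> X" and "k > 0"
    and lower: "\<And>x. x \<in> X \<Longrightarrow> m \<le> J x"
    and sublevel: "\<And>a. closed {x \<in> X. J x \<le> a}"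
  obtains x where "x \<in> X" and "J x \<le> J x0"
    and "\<And>y. y \<in> X \<Longrightarrow> J x - k * dist x y \<le> J y"
proof -
  \<comment> \<open>\<open>y \<in> S x\<close> is a partial order on \<open>X\<close>: moving from
    \<open>x\<close> to \<open>y\<close> lowers \<open>J\<close> by at least \<open>k\<close> times
    the distance. The point sought is one with \<open>S x = {x}\<close>.\<close>
  define S where "S x = {y \<in> X. J y + k * dist x y \<le> J x}" for x
  have S_refl: "x \<in> S x" if "x \<in> X" for x
    using that by (simp add: S_def)
  have S_trans: "z \<in> S x" if "y \<in> S x" "z \<in> S y" for x y z
  proof -
    have "k * dist x z \<le> k * dist x y + k * dist y z"
      using \<open>k > 0\<close> by (metis dist_triangle distrib_left less_imp_le mult_left_mono)
    with that show ?thesis by (auto simp: S_def)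
  qed
  have step: "\<exists>y. y \<in> S x \<and> (\<forall>z\<in>S x. J y \<le> J z + (1/2)^n)" if "x \<in> X" for x n
  proof -
    have ne: "S x \<noteq> {}" using S_refl[OF that] by auto
    have bdd: "bdd_below (J ` S x)"
      by (rule bdd_belowI2[of _ m]) (auto simp: S_def lower)
    have "(INF z\<in>S x. J z) < (INF z\<in>S x. J z) + (1/2)^n" by simp
    then obtain y where "y \<in> S x" "J y < (INF z\<in>S x. J z) + (1/2)^n"
      using cINF_less_iff[OF ne bdd] by blast
    moreover have "(INF z\<in>S x. J z) \<le> J z" if "z \<in> S x" for z
      using bdd that by (rule cINF_lower)
    ultimately show ?thesis by force
  qed
  have "\<exists>u. \<forall>n. (u n \<in> X \<and> (n = 0 \<longrightarrow> u n = x0)) \<and>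
      (u (Suc n) \<in> S (u n) \<and> (\<forall>z\<in>S (u n). J (u (Suc n)) \<le> J z + (1/2)^n))"
  proof (rule dependent_nat_choice)
    show "\<exists>x. x \<in> X \<and> (0 = (0::nat) \<longrightarrow> x = x0)" using \<open>x0 \<in> X\<close> by blast
  next
    fix x n assume "x \<in> X \<and> (n = (0::nat) \<longrightarrow> x = x0)"
    with step[of x n] show "\<exists>y. (y \<in> X \<and> (Suc n = 0 \<longrightarrow> y = x0)) \<and>
        y \<in> S x \<and> (\<forall>z\<in>S x. J y \<le> J z + (1/2)^n)"
      by (auto simp: S_def)
  qed
  then obtain u where uX: "\<And>n. u n \<in> X" and u0: "u 0 = x0"
    and uS: "\<And>n. u (Suc n) \<in> S (u n)"
    and umin: "\<And>n z. z \<in> S (u n) \<Longrightarrow> J (u (Suc n)) \<le> J z + (1/2)^n"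
    by blast
  have u_later: "u j \<in> S (u i)" if "i \<le> j" for i j
    using that
  proof (induction rule: dec_induct)
    case base
    then show ?case by (rule S_refl[OF uX])
  next
    case (step n)
    then show ?case using S_trans uS by blast
  qed
  \<comment> \<open>Distances along the sequence are paid for by drops of \<open>J\<close>, so the
    Cauchy property passes from the convergent values \<open>J (u n)\<close> to
    \<open>u\<close>.\<close>
  have u_dist: "k * dist (u i) (u j) \<le> \<bar>J (u i) - J (u j)\<bar>" for i j
    using u_later[of i j] u_later[of j i]
    by (cases "i \<le> j") (auto simp: S_def dist_commute)
  have "decseq (\<lambda>n. J (u n))"
  proof (rule decseq_SucI)
    fix n
    have "0 \<le> k * dist (u n) (u (Suc n))" using \<open>k > 0\<close> by simp
    with uS[of n] show "J (u (Suc n)) \<le> J (u n)" by (auto simp: S_def)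
  qed
  then obtain L where "(\<lambda>n. J (u n)) \<longlonglongrightarrow> L"
    by (rule decseq_convergent) (use uX lower in blast)
  then have JC: "Cauchy (\<lambda>n. J (u n))" by (rule LIMSEQ_imp_Cauchy)
  have "Cauchy u"
  proof (rule metric_CauchyI)
    fix \<delta> :: real assume "\<delta> > 0"
    then have "k * \<delta> > 0" using \<open>k > 0\<close> by simp
    then obtain N where N: "\<And>i j. i \<ge> N \<Longrightarrow> j \<ge> N \<Longrightarrow> \<bar>J (u i) - J (u j)\<bar> < k * \<delta>"
      using metric_CauchyD[OF JC] by (metis dist_real_def)
    have "dist (u i) (u j) < \<delta>" if "i \<ge> N" "j \<ge> N" for i j
      using le_less_trans[OF u_dist N[OF that]] \<open>k > 0\<close> by simp
    then show "\<exists>N. \<forall>i\<ge>N. \<forall>j\<ge>N. dist (u i) (u j) < \<delta>" by blast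
  qed
  then obtain x where ux: "u \<longlonglongrightarrow> x"
    using Cauchy_convergent convergent_def by blast
  have xS: "x \<in> S (u n)" for n
  proof -
    \<comment> \<open>Closedness is available only for a fixed level, while the bound on
      \<open>J (u l)\<close> varies with \<open>l\<close>. The slack \<delta> makes the level
      constant for late \<open>l\<close> and is removed afterwards.\<close>
    have key: "x \<in> X \<and> J x \<le> J (u n) - k * dist (u n) x + \<delta>" if "\<delta> > 0" for \<delta>
    proof -
      have "(\<lambda>l. J (u n) - k * dist (u n) (u l)) \<longlonglongrightarrow> J (u n) - k * dist (u n) x"
        by (intro tendsto_intros ux)
      then have "eventually (\<lambda>l. J (u n) - k * dist (u n) (u l)
          < J (u n) - k * dist (u n) x + \<delta>) sequentially"
        by (rule order_tendstoD) (use that in simp)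
      moreover have "eventually (\<lambda>l. u l \<in> S (u n)) sequentially"
        using eventually_ge_at_top[of n] by eventually_elim (rule u_later)
      ultimately have "eventually (\<lambda>l. u l \<in>
          {z \<in> X. J z \<le> J (u n) - k * dist (u n) x + \<delta>}) sequentially"
        by eventually_elim (auto simp: S_def)
      then have "x \<in> {z \<in> X. J z \<le> J (u n) - k * dist (u n) x + \<delta>}"
        by (rule Lim_in_closed_set[OF sublevel _ _ ux]) simp
      then show ?thesis by blast
    qed
    have "J x \<le> J (u n) - k * dist (u n) x"
      by (rule field_le_epsilon) (rule conjunct2[OF key])
    with key[of 1] show ?thesis by (simp add: S_def)
  qed
  have "J x \<le> J x0"
  proof -
    have "0 \<le> k * dist (u 0) x" using \<open>k > 0\<close> by simp
    with xS[of 0] show ?thesis by (auto simp: S_def u0)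
  qed
  moreover have "y = x" if "y \<in> S x" for y
  proof -
    \<comment> \<open>By transitivity \<open>y\<close> lies below every \<open>u n\<close>. Near
      minimality of \<open>u (Suc n)\<close> leaves \<open>J\<close> at most \<open>(1/2)^n\<close>
      to drop on the way to \<open>y\<close>, and that drop bounds the distance.\<close>
    have le: "k * dist (u (Suc n)) y \<le> (1/2)^n" for n
    proof -
      have "y \<in> S (u n)" "y \<in> S (u (Suc n))" using S_trans[OF xS that] by auto
      with umin[of y n] show ?thesis by (auto simp: S_def)
    qed
    have "(\<lambda>n. k * dist (u (Suc n)) y) \<longlonglongrightarrow> k * dist x y"
      by (intro tendsto_intros LIMSEQ_Suc ux)
    moreover have "(\<lambda>n. (1/2)^n :: real) \<longlonglongrightarrow> 0"
      by (intro LIMSEQ_power_zero) simp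
    ultimately have "k * dist x y \<le> 0"
      using le by (intro LIMSEQ_le) auto
    then have "dist x y \<le> 0" using \<open>k > 0\<close> by (simp add: mult_le_0_iff)
    then show ?thesis by simp
  qed
  moreover have "x \<in> X" using xS[of 0] by (simp add: S_def)
  ultimately show thesis
  proof (intro that)
    fix y assume uniq: "\<And>y. y \<in> S x \<Longrightarrow> y = x" and "y \<in> X"
    show "J x - k * dist x y \<le> J y"
    proof (rule ccontr)
      assume "\<not> ?thesis"
      then have "y \<in> S x" using \<open>y \<in> X\<close> by (simp add: S_def)
      with uniq have "y = x" by blast
      with \<open>\<not> ?thesis\<close> show False by simp
    qed
  qed auto
qed

section \<open>Continuous selections from convex sets\<close>

text \<open>Finitely many of the open sets carrying a constant selection cover \<open>S\<close>.
  Averaging these constants with a subordinate partition of unity gives a continuous map whose value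
  at \<open>x\<close> is a convex combination of points of \<open>C x\<close>.\<close>

theorem locally_constant_selection:
  fixes S :: "'a::metric_space set" and C :: "'a \<Rightarrow> 'b::real_normed_vector set"
  assumes "compact S"
    and convex: "\<And>x. x \<in> S \<Longrightarrow> convex (C x)"
    and local: "\<And>x. x \<in> S \<Longrightarrow> \<exists>v U. open U \<and> x \<in> U \<and> (\<forall>y\<in>U \<inter> S. v \<in> C y)"
  obtains f where "continuous_on S f" and "\<And>x. x \<in> S \<Longrightarrow> f x \<in> C x"
proof -
  define \<C> where "\<C> = {U. open U \<and> (\<exists>v. \<forall>y\<in>U \<inter> S. v \<in> C y)}"
  have "S \<subseteq> \<Union>\<C>" using local unfolding \<C>_def by blast
  with \<open>compact S\<close> obtain \<D> where \<D>: "\<D> \<subseteq> \<C>" "finite \<D>" "S \<subseteq> \<Union>\<D>"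
    by (rule compactE) (auto simp: \<C>_def)
  obtain v where v: "\<And>U y. U \<in> \<D> \<Longrightarrow> y \<in> U \<Longrightarrow> y \<in> S \<Longrightarrow> v U \<in> C y"
  proof -
    have "\<forall>U\<in>\<D>. \<exists>v. \<forall>y\<in>U \<inter> S. v \<in> C y" using \<D>(1) by (auto simp: \<C>_def)
    then show ?thesis using that by (metis IntI)
  qed
  obtain F :: "'a set \<Rightarrow> 'a \<Rightarrow> real" where
    F: "\<And>U. U \<in> \<D> \<Longrightarrow> continuous_on S (F U) \<and> (\<forall>x\<in>S. 0 \<le> F U x)"
    and F0: "\<And>x U. U \<in> \<D> \<Longrightarrow> x \<in> S \<Longrightarrow> x \<notin> U \<Longrightarrow> F U x = 0"
    and F1: "\<And>x. x \<in> S \<Longrightarrow> supp_sum (\<lambda>W. F W x) \<D> = 1"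
  proof (rule subordinate_partition_of_unity[of S \<D>])
    show "\<exists>V. open V \<and> x \<in> V \<and> finite {U \<in> \<D>. U \<inter> V \<noteq> {}}" for x
      using \<D>(2) by (intro exI[of _ UNIV]) auto
  qed (use \<D> in \<open>auto simp: \<C>_def\<close>)
  define f where "f x = (\<Sum>U\<in>\<D>. F U x *\<^sub>R v U)" for x
  have "continuous_on S f"
    unfolding f_def using F by (intro continuous_intros) auto
  moreover have "f x \<in> C x" if "x \<in> S" for x
  proof -
    \<comment> \<open>Only sets containing \<open>x\<close> have \<open>v U \<in> C x\<close>. A
      nonzero weight guarantees this, so the sum is cut down to such sets before convexity is
      used.\<close>
    define A where "A = {U \<in> \<D>. F U x \<noteq> 0}"
    have A: "finite A" using \<D>(2) by (simp add: A_def)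
    have "f x = (\<Sum>U\<in>A. F U x *\<^sub>R v U)"
      unfolding f_def A_def using \<D>(2) by (intro sum.mono_neutral_right) auto
    moreover have "(\<Sum>U\<in>A. F U x) = 1"
      using F1[OF that] by (simp add: A_def supp_sum_def support_on_def)
    moreover have "v U \<in> C x" if "U \<in> A" for U
      using that v F0 \<open>x \<in> S\<close> by (auto simp: A_def)
    ultimately show ?thesis
      using convex_sum[OF A convex[OF that]] F that by (auto simp: A_def)
  qed
  ultimately show thesis by (rule that)
qed


section \<open>Continuity, strict differentiability and convex difference quotients\<close>

lemma locally_lipschitz_imp_continuous_on:
  assumes "locally_lipschitz f"
  shows "continuous_on S f"
proof -
  have "isCont f x" for x
  proof -
    obtain r L where "r > 0" "L-lipschitz_on (ball x r) f"
      using assms unfolding locally_lipschitz_def by blast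
    then show ?thesis
      using lipschitz_on_continuous_on continuous_on_eq_continuous_at[OF open_ball]
      by (metis centre_in_ball)
  qed
  then show ?thesis by (simp add: continuous_at_imp_continuous_on)
qed

lemma C1_imp_continuous_on:
  assumes "C1_with_derivative f f'"
  shows "continuous_on S f"
  using assms unfolding C1_with_derivative_def
  by (meson continuous_at_imp_continuous_on has_derivative_continuous)

text \<open>The mean value inequality on a ball where \<open>f'\<close> stays within \<kappa> of
  \<open>f' x\<close>. Both endpoints may vary, which is needed later because the base points of the
  increments move along with the peaks.\<close>

lemma C1_strict_derivative:
  assumes "C1_with_derivative f f'" and "\<kappa> > 0"
  obtains \<delta> where "\<delta> > 0"
    and "\<And>u v. u \<in> ball x \<delta> \<Longrightarrow> v \<in> ball x \<delta> \<Longrightarrow>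
      \<bar>f v - f u - blinfun_apply (f' x) (v - u)\<bar> \<le> \<kappa> * norm (v - u)"
proof -
  have der: "\<And>y. (f has_derivative blinfun_apply (f' y)) (at y)"
    and cont: "continuous_on UNIV f'"
    using assms(1) by (auto simp: C1_with_derivative_def)
  obtain \<delta> where "\<delta> > 0" and \<delta>: "\<And>y. dist y x < \<delta> \<Longrightarrow> dist (f' y) (f' x) < \<kappa>"
    using cont \<open>\<kappa> > 0\<close> by (metis UNIV_I continuous_on_iff)
  show thesis
  proof
    fix u v assume uv: "u \<in> ball x \<delta>" "v \<in> ball x \<delta>"
    have "norm (f v - f u - blinfun_apply (f' x) (v - u)) \<le> norm (v - u) * \<kappa>"
    proof (rule differentiable_bound_linearization[where S = "ball x \<delta>"])
      fix t :: real assume t: "t \<in> {0..1}"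
      have "(1 - t) *\<^sub>R u + t *\<^sub>R v \<in> ball x \<delta>"
        using t by (intro convexD[OF convex_ball] uv) auto
      then show "u + t *\<^sub>R (v - u) \<in> ball x \<delta>"
        by (simp add: algebra_simps)
    next
      fix y assume y: "y \<in> ball x \<delta>"
      show "(f has_derivative blinfun_apply (f' y)) (at y within ball x \<delta>)"
        using der by (rule has_derivative_at_withinI)
      have "onorm (blinfun_apply (f' y - f' x)) \<le> \<kappa>"
        using \<delta>[of y] y by (simp add: dist_norm norm_blinfun.rep_eq[symmetric] norm_minus_commute)
      then show "onorm (blinfun_apply (f' y) - blinfun_apply (f' x)) \<le> \<kappa>"
        by (simp add: minus_blinfun.rep_eq fun_diff_def)
    qed (use \<open>\<delta> > 0\<close> in simp)
    then show "\<bar>f v - f u - blinfun_apply (f' x) (v - u)\<bar> \<le> \<kappa> * norm (v - u)"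
      by (simp add: mult.commute)
  qed fact
qed

text \<open>The point at step \<open>s\<close> is the convex combination, with weight
  \<open>s/r\<close>, of \<open>x\<close> and the point at step \<open>r\<close>.\<close>

lemma convex_on_difference_quotient_mono:
  fixes f :: "'a::real_vector \<Rightarrow> real"
  assumes "convex_on UNIV f" and "0 < s" and "s \<le> r"
  shows "(f (x + s *\<^sub>R h) - f x) / s \<le> (f (x + r *\<^sub>R h) - f x) / r"
proof -
  have "f ((1 - s/r) *\<^sub>R x + (s/r) *\<^sub>R (x + r *\<^sub>R h)) \<le> (1 - s/r) * f x + (s/r) * f (x + r *\<^sub>R h)"
    using assms by (intro convex_onD[OF assms(1)]) auto
  moreover have "(1 - s/r) *\<^sub>R x + (s/r) *\<^sub>R (x + r *\<^sub>R h) = x + s *\<^sub>R h"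
    using assms by (simp add: algebra_simps)
  ultimately have "f (x + s *\<^sub>R h) - f x \<le> s * ((f (x + r *\<^sub>R h) - f x) / r)"
    using assms by (simp add: field_simps)
  then show ?thesis
    using assms by (simp add: pos_divide_le_eq mult.commute)
qed


section \<open>Descent fields and the limit of perturbed peaks\<close>

text \<open>In the application \<open>K\<close> holds the peak times of a path and \<open>Z\<close>
  its endpoints. The field is a selection from the sets \<open>C t\<close>, which collect all
  requirements at time \<open>t\<close>; the step witnessing descent may depend on
  \<open>t\<close>.\<close>

lemma descent_field:
  fixes I0 :: "'a::real_normed_vector \<Rightarrow> real" and D :: "'b::metric_space \<Rightarrow> 'a \<Rightarrow>\<^sub>L real"
  assumes conv: "convex_on UNIV I0" and I0_cont: "continuous_on UNIV I0"
    and S: "compact S" and \<gamma>: "continuous_on S \<gamma>" and D: "continuous_on S D"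
    and "closed K" and "closed Z" and "K \<inter> Z = {}"
    and steep: "\<And>t. t \<in> K \<Longrightarrow> \<exists>y. I0 y - I0 (\<gamma> t) < D t (y - \<gamma> t) - \<epsilon> * norm (y - \<gamma> t)"
  obtains h where "continuous_on S h" and "\<And>t. t \<in> S \<Longrightarrow> norm (h t) \<le> 1"
    and "\<And>t. t \<in> S \<inter> Z \<Longrightarrow> h t = 0"
    and "\<And>t. t \<in> S \<inter> K \<Longrightarrow> \<exists>r>0. (I0 (\<gamma> t + r *\<^sub>R h t) - I0 (\<gamma> t)) / r < D t (h t) - \<epsilon>"
proof -
  define Q where "Q t r h = (I0 (\<gamma> t + r *\<^sub>R h) - I0 (\<gamma> t)) / r" for t r h
  define A where "A t = {h. \<exists>r>0. Q t r h < D t h - \<epsilon>}" for t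
  \<comment> \<open>\<open>A t\<close> is convex because the difference quotients of \<open>I0\<close> shrink with the step: two
    directions are both admissible at the smaller of their steps.\<close>
  define C where "C t = cball 0 1 \<inter> (if t \<in> Z then {0} else UNIV) \<inter> (if t \<in> K then A t else UNIV)" for t
  have "convex (A t)" for t
  proof (rule convexI)
    fix u v :: 'a and a b :: real
    assume "u \<in> A t" "v \<in> A t" and ab: "0 \<le> a" "0 \<le> b" "a + b = 1"
    then obtain p q where p: "p > 0" "Q t p u < D t u - \<epsilon>" and q: "q > 0" "Q t q v < D t v - \<epsilon>"
      by (auto simp: A_def)
    define r where "r = min p q"
    have r: "r > 0" "r \<le> p" "r \<le> q" using p q by (auto simp: r_def)
    have u: "Q t r u < D t u - \<epsilon>" and v: "Q t r v < D t v - \<epsilon>"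
      unfolding Q_def
      using convex_on_difference_quotient_mono[OF conv r(1) r(2), of "\<gamma> t" u]
        convex_on_difference_quotient_mono[OF conv r(1) r(3), of "\<gamma> t" v] p q
      by (auto simp: Q_def)
    have a: "a = 1 - b" using ab by simp
    have "I0 ((1 - b) *\<^sub>R (\<gamma> t + r *\<^sub>R u) + b *\<^sub>R (\<gamma> t + r *\<^sub>R v))
        \<le> (1 - b) * I0 (\<gamma> t + r *\<^sub>R u) + b * I0 (\<gamma> t + r *\<^sub>R v)"
      using ab by (intro convex_onD[OF conv]) auto
    moreover have "(1 - b) *\<^sub>R (\<gamma> t + r *\<^sub>R u) + b *\<^sub>R (\<gamma> t + r *\<^sub>R v)
        = \<gamma> t + r *\<^sub>R (a *\<^sub>R u + b *\<^sub>R v)"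
      by (simp add: a algebra_simps)
    ultimately have le: "I0 (\<gamma> t + r *\<^sub>R (a *\<^sub>R u + b *\<^sub>R v))
        \<le> (1 - b) * I0 (\<gamma> t + r *\<^sub>R u) + b * I0 (\<gamma> t + r *\<^sub>R v)"
      by simp
    have rQ: "I0 (\<gamma> t + r *\<^sub>R w) = I0 (\<gamma> t) + r * Q t r w" for w
      using r(1) by (simp add: Q_def)
    from le have "I0 (\<gamma> t) + r * Q t r (a *\<^sub>R u + b *\<^sub>R v)
        \<le> (1 - b) * (I0 (\<gamma> t) + r * Q t r u) + b * (I0 (\<gamma> t) + r * Q t r v)"
      unfolding rQ .
    also have "\<dots> = I0 (\<gamma> t) + r * (a * Q t r u + b * Q t r v)"
      unfolding a by (simp add: algebra_simps)
    finally have "r * Q t r (a *\<^sub>R u + b *\<^sub>R v) \<le> r * (a * Q t r u + b * Q t r v)"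
      by simp
    then have "Q t r (a *\<^sub>R u + b *\<^sub>R v) \<le> a * Q t r u + b * Q t r v"
      using r(1) by simp
    \<comment> \<open>Strictness is drawn from the summand with weight \<open>b\<close>; for
      \<open>b = 0\<close> the other weight is 1.\<close>
    also have "\<dots> < a * (D t u - \<epsilon>) + b * (D t v - \<epsilon>)"
    proof (cases "b = 0")
      case True
      with u a show ?thesis by simp
    next
      case False
      with u v ab show ?thesis
        by (intro add_le_less_mono mult_left_mono mult_strict_left_mono) auto
    qed
    also have "\<dots> = D t (a *\<^sub>R u + b *\<^sub>R v) - \<epsilon>"
      by (simp add: blinfun.add_right blinfun.scaleR_right) (simp add: a algebra_simps)
    finally show "a *\<^sub>R u + b *\<^sub>R v \<in> A t" using r(1) by (auto simp: A_def)
  qed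
  then have "convex (C t)" for t
    by (simp add: C_def convex_Int)
  moreover have "\<exists>h U. open U \<and> t \<in> U \<and> (\<forall>s\<in>U \<inter> S. h \<in> C s)" if "t \<in> S" for t
  proof (cases "t \<in> K")
    \<comment> \<open>Off \<open>K\<close> the zero direction meets every requirement, and the
      complement of \<open>K\<close> is open.\<close>
    case False
    then show ?thesis
      using \<open>closed K\<close> by (intro exI[of _ 0] exI[of _ "- K"]) (auto simp: C_def)
  next
    case True
    then obtain y where y: "I0 y - I0 (\<gamma> t) < D t (y - \<gamma> t) - \<epsilon> * norm (y - \<gamma> t)"
      using steep by blast
    \<comment> \<open>Normalising \<open>y - \<gamma> t\<close> turns the penalty into
      \<open>r * \<epsilon>\<close>, so steepness becomes a bound on the difference quotient with
      step \<open>r\<close>. Here \<open>r > 0\<close>, since \<open>y = \<gamma> t\<close> would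
      make the strict inequality read 0 < 0.\<close>
    define r where "r = norm (y - \<gamma> t)"
    define h where "h = (y - \<gamma> t) /\<^sub>R r"
    have "r > 0" using y by (auto simp: r_def)
    have rh: "y - \<gamma> t = r *\<^sub>R h" using \<open>r > 0\<close> by (simp add: h_def)
    have "norm h = 1" using \<open>r > 0\<close> by (simp add: h_def r_def)
    \<comment> \<open>With direction and step frozen, admissibility is an open condition on the
      time. Removing \<open>Z\<close> from the neighbourhood avoids the times at which only 0 is
      allowed.\<close>
    have "continuous_on S (\<lambda>s. Q s r h - D s h)"
      unfolding Q_def
      by (intro continuous_intros continuous_on_compose2[OF I0_cont] \<gamma> D) (use \<open>r > 0\<close> in auto)
    then obtain U where U: "open U" "U \<inter> S = (\<lambda>s. Q s r h - D s h) -` {..<- \<epsilon>} \<inter> S"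
      unfolding continuous_on_open_invariant by (meson open_lessThan)
    have "y = \<gamma> t + r *\<^sub>R h" using rh by (simp add: algebra_simps)
    with y have "I0 (\<gamma> t + r *\<^sub>R h) - I0 (\<gamma> t) < r * (D t h - \<epsilon>)"
      unfolding r_def[symmetric] rh
      using \<open>r > 0\<close> \<open>norm h = 1\<close> by (simp add: blinfun.scaleR_right algebra_simps)
    then have "Q t r h - D t h < - \<epsilon>"
      using \<open>r > 0\<close> unfolding Q_def by (simp add: field_simps)
    then have "t \<in> U" using U(2) \<open>t \<in> S\<close> by auto
    moreover have "h \<in> C s" if "s \<in> U - Z" "s \<in> S" for s
    proof -
      have "s \<in> (\<lambda>s. Q s r h - D s h) -` {..<- \<epsilon>}" using U(2) that by blast
      then have "h \<in> A s" using \<open>r > 0\<close> by (auto simp: A_def)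
      then show ?thesis using \<open>norm h = 1\<close> that by (simp add: C_def)
    qed
    moreover have "t \<notin> Z" using True \<open>K \<inter> Z = {}\<close> by blast
    ultimately show ?thesis
      using U(1) \<open>closed Z\<close> by (intro exI[of _ h] exI[of _ "U - Z"]) (auto simp: open_Diff)
  qed
  ultimately obtain h where "continuous_on S h" and h: "\<And>t. t \<in> S \<Longrightarrow> h t \<in> C t"
    using locally_constant_selection[OF S, of C] by blast
  show thesis
  proof
    show "continuous_on S h" by fact
    show "norm (h t) \<le> 1" if "t \<in> S" for t using h[OF that] by (simp add: C_def)
    show "h t = 0" if "t \<in> S \<inter> Z" for t using h[of t] that by (simp add: C_def)
    show "\<exists>r>0. (I0 (\<gamma> t + r *\<^sub>R h t) - I0 (\<gamma> t)) / r < D t (h t) - \<epsilon>"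
      if "t \<in> S \<inter> K" for t using h[of t] that by (simp add: C_def A_def Q_def)
  qed
qed

text \<open>At a perturbed peak the increment of \<open>I0\<close> is at least that of
  \<open>I\<close> minus \<open>k * r n\<close>. Dividing by \<open>r n\<close>, the increment of
  \<open>I\<close> tends to the derivative, while convexity replaces the quotient of
  \<open>I0\<close> at the shrinking step by the larger one at a fixed step \<open>q\<close>; the
  latter passes to the limit by continuity of \<open>I0\<close> alone.\<close>

lemma limit_of_perturbed_peaks:
  fixes I0 I :: "'a::real_normed_vector \<Rightarrow> real" and \<gamma> h :: "'b::metric_space \<Rightarrow> 'a"
  assumes conv: "convex_on UNIV I0" and I0_cont: "continuous_on UNIV I0"
    and C1: "C1_with_derivative I I'"
    and S: "compact S" and \<gamma>: "continuous_on S \<gamma>" and h: "continuous_on S h"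
    and h1: "\<And>t. t \<in> S \<Longrightarrow> norm (h t) \<le> 1"
    and r: "\<And>n. r n > 0" "r \<longlonglongrightarrow> 0" and s: "\<And>n::nat. s n \<in> S"
    and peak: "\<And>n. M - k * r n \<le> I0 (\<gamma> (s n) + r n *\<^sub>R h (s n)) - I (\<gamma> (s n) + r n *\<^sub>R h (s n))"
    and le_M: "\<And>t. t \<in> S \<Longrightarrow> I0 (\<gamma> t) - I (\<gamma> t) \<le> M"
  obtains t where "t \<in> S" and "I0 (\<gamma> t) - I (\<gamma> t) = M"
    and "\<And>q. q > 0 \<Longrightarrow> I' (\<gamma> t) (h t) - k \<le> (I0 (\<gamma> t + q *\<^sub>R h t) - I0 (\<gamma> t)) / q"
proof -
  have I_cont: "continuous_on UNIV I" using C1 by (rule C1_imp_continuous_on)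
  obtain t \<sigma> where "t \<in> S" and \<sigma>: "strict_mono \<sigma>" and st: "(s \<circ> \<sigma>) \<longlonglongrightarrow> t"
    using S s by (metis compact_def)
  define R where "R n = r (\<sigma> n)" for n
  define P where "P n = \<gamma> (s (\<sigma> n))" for n
  define H where "H n = h (s (\<sigma> n))" for n
  have R0: "R \<longlonglongrightarrow> 0" and R: "\<And>n. R n > 0"
    using LIMSEQ_subseq_LIMSEQ[OF r(2) \<sigma>] r(1) by (auto simp: R_def[abs_def] o_def)
  have PL: "P \<longlonglongrightarrow> \<gamma> t" and HL: "H \<longlonglongrightarrow> h t"
    using continuous_on_tendsto_compose[OF \<gamma> st \<open>t \<in> S\<close>]
      continuous_on_tendsto_compose[OF h st \<open>t \<in> S\<close>] s
    by (auto simp: P_def[abs_def] H_def[abs_def])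
  have PHL: "(\<lambda>n. P n + R n *\<^sub>R H n) \<longlonglongrightarrow> \<gamma> t"
    using tendsto_add[OF PL tendsto_scaleR[OF R0 HL]] by simp
  have I0L: "(\<lambda>n. I0 (x n)) \<longlonglongrightarrow> I0 y" and IL: "(\<lambda>n. I (x n)) \<longlonglongrightarrow> I y"
    if "x \<longlonglongrightarrow> y" for x y
    using continuous_on_tendsto_compose[OF I0_cont that] continuous_on_tendsto_compose[OF I_cont that]
    by auto
  have pk: "M - k * R n \<le> I0 (P n + R n *\<^sub>R H n) - I (P n + R n *\<^sub>R H n)" for n
    using peak by (simp add: P_def R_def H_def)
  have PM: "I0 (P n) - I (P n) \<le> M" for n
    using le_M s by (simp add: P_def)
  have "M - k * 0 \<le> I0 (\<gamma> t) - I (\<gamma> t)"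
    using pk
    by (intro LIMSEQ_le[of "\<lambda>n. M - k * R n" _ "\<lambda>n. I0 (P n + R n *\<^sub>R H n) - I (P n + R n *\<^sub>R H n)"]
        tendsto_intros R0 I0L IL PHL) auto
  then have "I0 (\<gamma> t) - I (\<gamma> t) = M"
    using le_M[OF \<open>t \<in> S\<close>] by simp
  moreover have "I' (\<gamma> t) (h t) - k \<le> (I0 (\<gamma> t + q *\<^sub>R h t) - I0 (\<gamma> t)) / q" if "q > 0" for q
  proof (rule field_le_epsilon)
    fix \<kappa> :: real assume "\<kappa> > 0"
    obtain \<delta> where "\<delta> > 0" and \<delta>: "\<And>u v. u \<in> ball (\<gamma> t) \<delta> \<Longrightarrow> v \<in> ball (\<gamma> t) \<delta> \<Longrightarrow>
        \<bar>I v - I u - blinfun_apply (I' (\<gamma> t)) (v - u)\<bar> \<le> \<kappa> * norm (v - u)"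
      using C1_strict_derivative[OF C1 \<open>\<kappa> > 0\<close>, of "\<gamma> t"] by blast
    have ball: "eventually (\<lambda>n. x n \<in> ball (\<gamma> t) \<delta>) sequentially" if "x \<longlonglongrightarrow> \<gamma> t" for x
      using topological_tendstoD[OF that open_ball] \<open>\<delta> > 0\<close> by simp
    have "eventually (\<lambda>n. R n < q) sequentially"
      using order_tendstoD(2)[OF R0] that by blast
    with ball[OF PL] ball[OF PHL]
    have "eventually (\<lambda>n. I' (\<gamma> t) (H n) - k \<le> (I0 (P n + q *\<^sub>R H n) - I0 (P n)) / q + \<kappa>) sequentially"
    proof eventually_elim
      case (elim n)
      have "(I0 (P n + R n *\<^sub>R H n) - I0 (P n)) / R n \<le> (I0 (P n + q *\<^sub>R H n) - I0 (P n)) / q"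
        using elim R by (intro convex_on_difference_quotient_mono conv) auto
      then have 1: "I0 (P n + R n *\<^sub>R H n) - I0 (P n) \<le> R n * ((I0 (P n + q *\<^sub>R H n) - I0 (P n)) / q)"
        using R[of n] by (simp add: pos_divide_le_eq mult.commute)
      have "\<bar>I (P n + R n *\<^sub>R H n) - I (P n) - R n * I' (\<gamma> t) (H n)\<bar> \<le> \<kappa> * norm (R n *\<^sub>R H n)"
        using \<delta>[OF elim(1,2)] by (simp add: blinfun.scaleR_right)
      also have "\<dots> \<le> \<kappa> * R n"
        using h1[OF s] R[of n] \<open>\<kappa> > 0\<close> by (simp add: H_def mult_left_le)
      finally have 2: "R n * I' (\<gamma> t) (H n) - \<kappa> * R n \<le> I (P n + R n *\<^sub>R H n) - I (P n)"
        by linarith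
      \<comment> \<open>Subtracting \<open>PM\<close> from \<open>pk\<close> compares the increments
        of \<open>I0\<close> and \<open>I\<close>; \<open>1\<close> bounds the former above and
        \<open>2\<close> the latter below, with \<kappa> absorbing the linearisation error.\<close>
      have "R n * (I' (\<gamma> t) (H n) - k) \<le> R n * ((I0 (P n + q *\<^sub>R H n) - I0 (P n)) / q + \<kappa>)"
        using 1 2 pk[of n] PM[of n] unfolding right_diff_distrib distrib_left
        by (simp add: mult.commute)
      then show ?case using R[of n] by simp
    qed
    moreover have "(\<lambda>n. I' (\<gamma> t) (H n) - k) \<longlonglongrightarrow> I' (\<gamma> t) (h t) - k"
      by (intro tendsto_intros HL)
    moreover have "(\<lambda>n. (I0 (P n + q *\<^sub>R H n) - I0 (P n)) / q + \<kappa>)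
        \<longlonglongrightarrow> (I0 (\<gamma> t + q *\<^sub>R h t) - I0 (\<gamma> t)) / q + \<kappa>"
      using that by (intro tendsto_intros I0L PL HL) auto
    ultimately show "I' (\<gamma> t) (h t) - k \<le> (I0 (\<gamma> t + q *\<^sub>R h t) - I0 (\<gamma> t)) / q + \<kappa>"
      by (rule_tac tendsto_le[OF sequentially_bot]) auto
  qed
  ultimately show thesis using that \<open>t \<in> S\<close> by blast
qed


section \<open>The minimax argument on the space of paths\<close>

lemma cSUP_compact_le_iff:
  fixes g :: "'a::topological_space \<Rightarrow> real"
  assumes "compact S" and "S \<noteq> {}" and "continuous_on S g"
  shows "(SUP t\<in>S. g t) \<le> a \<longleftrightarrow> (\<forall>t\<in>S. g t \<le> a)"
proof -
  have "bdd_above (g ` S)"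
    using assms by (intro bounded_imp_bdd_above compact_imp_bounded compact_continuous_image)
  then show ?thesis using \<open>S \<noteq> {}\<close> by (rule cSUP_le_iff[rotated])
qed

theorem theorem4p1:
  fixes I0 I \<Phi> :: "'a::banach \<Rightarrow> real"
    and I' :: "'a \<Rightarrow> ('a \<Rightarrow>\<^sub>L real)"
    and \<rho> \<alpha> c :: real
    and e :: 'a
  assumes "C1_with_derivative I I'"
    and "locally_lipschitz I0"
    and "convex_on UNIV I0"
    and "\<Phi> = (\<lambda>x. I0 x - I x)"
    and "\<rho> > 0"
    and "\<alpha> > \<Phi> 0"
    and "\<forall>x\<in>frontier (ball 0 \<rho>). \<Phi> x \<ge> \<alpha>"
    and "e \<notin> closure (ball 0 \<rho>)"
    and "\<Phi> e < \<Phi> 0"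
    and "c = minimax_level \<Phi> e"
  shows "c \<ge> \<alpha> \<and>
    (\<forall>\<epsilon>>0. \<exists>x. c - \<epsilon> < \<Phi> x \<and> \<Phi> x < c + \<epsilon> \<and>
       (\<forall>y. I0 y - I0 x \<ge> blinfun_apply (I' x) (y - x) - \<epsilon> * norm (y - x)))"
proof -
  note C1 = assms(1) and conv = assms(3)
  have \<Phi>: "\<Phi> x = I0 x - I x" for x using assms(4) by simp
  have I0_cont: "continuous_on UNIV I0"
    using assms(2) by (rule locally_lipschitz_imp_continuous_on)
  have \<Phi>_cont: "continuous_on A \<Phi>" for A
    unfolding assms(4)
    by (intro continuous_intros C1_imp_continuous_on[OF C1] locally_lipschitz_imp_continuous_on[OF assms(2)])
  have I'_cont: "continuous_on UNIV I'" using C1 by (simp add: C1_with_derivative_def)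
  define J where "J \<gamma> = (SUP t\<in>{0..1}. \<Phi> (\<gamma> t))" for \<gamma> :: "real \<Rightarrow> 'a"
  have c: "c = (INF \<gamma>\<in>paths_to e. J \<gamma>)" by (simp add: assms(10) minimax_level_def J_def)
  have \<Phi>\<gamma>_cont: "continuous_on {0..1} (\<lambda>t. \<Phi> (\<gamma> t))"
    if "continuous_on {0..1} \<gamma>" for \<gamma> :: "real \<Rightarrow> 'a"
    by (rule continuous_on_compose2[OF \<Phi>_cont that subset_UNIV])
  have J_le_iff: "J \<gamma> \<le> a \<longleftrightarrow> (\<forall>t\<in>{0..1}. \<Phi> (\<gamma> t) \<le> a)"
    if "continuous_on {0..1} \<gamma>" for \<gamma> a
    unfolding J_def by (rule cSUP_compact_le_iff) (use \<Phi>\<gamma>_cont[OF that] in auto)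
  have \<Phi>_le_J: "\<Phi> (\<gamma> t) \<le> J \<gamma>" if "continuous_on {0..1} \<gamma>" "t \<in> {0..1}" for \<gamma> t
    using J_le_iff[OF that(1), of "J \<gamma>"] that(2) by simp
  have "norm e > \<rho>" using assms(8) \<open>\<rho> > 0\<close> by simp
  have J_ge: "\<alpha> \<le> J \<gamma>" if "\<gamma> \<in> paths_to e" for \<gamma>
  proof -
    have \<gamma>: "continuous_on {0..1} \<gamma>" "\<gamma> 0 = 0" "\<gamma> 1 = e" using that by (auto simp: paths_to_def)
    have "\<exists>t\<ge>0. t \<le> 1 \<and> norm (\<gamma> t) = \<rho>"
      by (rule IVT') (use \<gamma> \<open>\<rho> > 0\<close> \<open>norm e > \<rho>\<close> in \<open>auto intro: continuous_on_norm\<close>)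
    then obtain t where t: "t \<in> {0..1}" "norm (\<gamma> t) = \<rho>" by auto
    then have "\<alpha> \<le> \<Phi> (\<gamma> t)" using assms(7) \<open>\<rho> > 0\<close> by simp
    also have "\<dots> \<le> J \<gamma>" by (rule \<Phi>_le_J[OF \<gamma>(1) t(1)])
    finally show ?thesis .
  qed
  have "(\<lambda>t. t *\<^sub>R e) \<in> paths_to e"
    by (auto simp: paths_to_def intro!: continuous_intros)
  then have paths_ne: "paths_to e \<noteq> {}" by blast
  have bdd: "bdd_below (J ` paths_to e)" using J_ge by (rule bdd_belowI2)
  have "\<alpha> \<le> c" unfolding c using paths_ne J_ge by (rule cINF_greatest)
  have c_le_J: "c \<le> J \<gamma>" if "\<gamma> \<in> paths_to e" for \<gamma>
    unfolding c using bdd that by (rule cINF_lower)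
  moreover have "\<exists>x. c - \<epsilon> < \<Phi> x \<and> \<Phi> x < c + \<epsilon> \<and>
       (\<forall>y. I0 y - I0 x \<ge> blinfun_apply (I' x) (y - x) - \<epsilon> * norm (y - x))"
    if "\<epsilon> > 0" for \<epsilon>
  proof (rule ccontr)
    assume contra: "\<not> ?thesis"
    have steep: "\<exists>y. I0 y - I0 x < I' x (y - x) - \<epsilon> * norm (y - x)"
      if "c - \<epsilon> < \<Phi> x" "\<Phi> x < c + \<epsilon>" for x
      using contra that by (meson not_le)
    \<comment> \<open>Paths are represented by bounded continuous functions on the whole line, which
      supplies a complete sup metric. \<open>J\<close> sees only the values on [0,1], but the metric
      sees all of them.\<close>
    define X :: "(real \<Rightarrow>\<^sub>C 'a) set" where "X = {f. apply_bcontfun f \<in> paths_to e}"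
    have X_iff: "f \<in> X \<longleftrightarrow> f 0 = 0 \<and> f 1 = e" for f
      by (simp add: X_def paths_to_def)
    have eval_cont: "continuous_on UNIV (\<lambda>f::real \<Rightarrow>\<^sub>C 'a. apply_bcontfun f t)" for t
      unfolding continuous_on_iff by (metis dist_bounded le_less_trans)
    have sublevel: "closed {f \<in> X. J f \<le> a}" for a
    proof -
      \<comment> \<open>Every condition here concerns the value of \<open>f\<close> at one time, and
        evaluation is continuous for the sup metric.\<close>
      have "{f \<in> X. J f \<le> a} = {f. apply_bcontfun f 0 = 0} \<inter> {f. apply_bcontfun f 1 = e} \<inter> (\<Inter>t\<in>{0..1}. {f. \<Phi> (apply_bcontfun f t) \<le> a})"
        by (auto simp: X_iff J_le_iff)
      also have "closed \<dots>"
        by (intro closed_Int closed_INT ballI closed_Collect_eq closed_Collect_le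
            continuous_intros eval_cont continuous_on_compose2[OF \<Phi>_cont[of UNIV] eval_cont]) auto
      finally show ?thesis .
    qed
    obtain \<gamma>0 where \<gamma>0: "\<gamma>0 \<in> paths_to e" "J \<gamma>0 < c + \<epsilon>"
      using cINF_less_iff[OF paths_ne bdd, of "c + \<epsilon>"] \<open>\<epsilon> > 0\<close> unfolding c by auto
    have "continuous_on (cbox 0 1) \<gamma>0" using \<gamma>0(1) by (simp add: paths_to_def)
    then obtain f0 :: "real \<Rightarrow>\<^sub>C 'a" where f0: "\<And>t. t \<in> {0..1} \<Longrightarrow> f0 t = \<gamma>0 t"
      by (rule continuous_on_cbox_bcontfunE) (metis cbox_interval)
    have "f0 \<in> X" using f0 \<gamma>0(1) by (simp add: X_iff paths_to_def)
    have "J f0 = J \<gamma>0" using f0 by (simp add: J_def)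
    \<comment> \<open>The slope \<epsilon>/2 is strictly below the \<epsilon> of
      \<open>steep\<close>; this gap gives the final contradiction.\<close>
    obtain \<gamma> where "\<gamma> \<in> X" "J \<gamma> \<le> J f0"
      and ekeland: "\<And>\<eta>. \<eta> \<in> X \<Longrightarrow> J \<gamma> - \<epsilon>/2 * dist \<gamma> \<eta> \<le> J \<eta>"
    proof (rule ekeland_variational_principle[OF \<open>f0 \<in> X\<close>, of "\<epsilon>/2" \<alpha> "\<lambda>f. J f"])
      show "\<alpha> \<le> J f" if "f \<in> X" for f using that J_ge by (simp add: X_def)
    qed (use sublevel \<open>\<epsilon> > 0\<close> in auto)
    have J\<gamma>: "c \<le> J \<gamma>" "J \<gamma> < c + \<epsilon>"
      using \<open>\<gamma> \<in> X\<close> c_le_J \<open>J \<gamma> \<le> J f0\<close> \<open>J f0 = J \<gamma>0\<close> \<gamma>0(2) by (auto simp: X_def)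
    define K where "K = {t \<in> {0..1}. \<Phi> (\<gamma> t) = J \<gamma>}"
    have "closed K"
      unfolding K_def by (intro continuous_closed_preimage_constant \<Phi>\<gamma>_cont) auto
    \<comment> \<open>The endpoint values lie strictly below the height of the path: \<Phi> e <
      \<Phi> 0 < \<alpha> \<le> c \<le> \<open>J \<gamma>\<close>. Hence the field may vanish at the
      endpoints and still descend on \<open>K\<close>.\<close>
    have "K \<inter> {0, 1} = {}"
      using \<open>\<gamma> \<in> X\<close> J\<gamma>(1) \<open>\<alpha> \<le> c\<close> assms(6,9) by (auto simp: K_def X_iff)
    obtain h0 where h0: "continuous_on {0..1} h0" "\<And>t. t \<in> {0..1} \<Longrightarrow> norm (h0 t) \<le> 1"
      "\<And>t. t \<in> {0..1} \<inter> {0, 1} \<Longrightarrow> h0 t = 0"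
      "\<And>t. t \<in> {0..1} \<inter> K \<Longrightarrow>
        \<exists>r>0. (I0 (\<gamma> t + r *\<^sub>R h0 t) - I0 (\<gamma> t)) / r < I' (\<gamma> t) (h0 t) - \<epsilon>"
    proof (rule descent_field[OF conv I0_cont, of "{0..1}" \<gamma> "\<lambda>t. I' (\<gamma> t)" K "{0, 1}" \<epsilon>])
      show "continuous_on {0..1} (\<lambda>t. I' (\<gamma> t))"
        by (rule continuous_on_compose2[OF I'_cont]) auto
      show "\<exists>y. I0 y - I0 (\<gamma> t) < I' (\<gamma> t) (y - \<gamma> t) - \<epsilon> * norm (y - \<gamma> t)" if "t \<in> K" for t
        using that J\<gamma> \<open>\<epsilon> > 0\<close> by (intro steep) (auto simp: K_def)
    qed (use \<open>closed K\<close> \<open>K \<inter> {0, 1} = {}\<close> in auto)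
    have "continuous_on (cbox 0 1) h0" using h0(1) by simp
    then obtain h :: "real \<Rightarrow>\<^sub>C 'a" where h: "\<And>t. t \<in> {0..1} \<Longrightarrow> h t = h0 t"
      and h_clamp: "\<And>t. h t = h0 (clamp 0 1 t)"
      by (rule continuous_on_cbox_bcontfunE) (metis cbox_interval)
    \<comment> \<open>The norm of \<open>h\<close> is a supremum over all reals. Extending by
      clamping repeats endpoint values outside [0,1], so the bound 1 holds everywhere.\<close>
    have "clamp 0 1 t \<in> {0..1}" for t :: real
      using clamp_in_interval[of 0 1 t] by simp
    then have "norm h \<le> 1"
      by (intro norm_bound) (simp add: h_clamp h0(2))
    define r :: "nat \<Rightarrow> real" where "r n = inverse (real (Suc n))" for n
    have r: "r n > 0" "r \<longlonglongrightarrow> 0" for n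
      using LIMSEQ_inverse_real_of_nat by (auto simp: r_def[abs_def])
    have "\<exists>s\<in>{0..1}. J \<gamma> - \<epsilon>/2 * r n \<le> \<Phi> (\<gamma> s + r n *\<^sub>R h s)" for n
    proof -
      \<comment> \<open>This competitor keeps its endpoints because \<open>h\<close> vanishes there,
        and lies within \<open>r n\<close> of \<gamma>, so Ekeland's inequality allows its height to
        fall by at most \<open>\<epsilon>/2 * r n\<close>.\<close>
      define \<eta> where "\<eta> = \<gamma> + r n *\<^sub>R h"
      have "\<eta> \<in> X" using \<open>\<gamma> \<in> X\<close> h h0(3) by (simp add: \<eta>_def X_iff)
      have "\<exists>s\<in>{0..1}. \<forall>t\<in>{0..1}. \<Phi> (\<eta> t) \<le> \<Phi> (\<eta> s)"
        by (rule continuous_attains_sup) (auto intro: \<Phi>\<gamma>_cont)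
      then obtain s where s: "s \<in> {0..1}" "J \<eta> \<le> \<Phi> (\<eta> s)"
        by (auto simp: J_le_iff)
      have "dist \<gamma> \<eta> \<le> r n"
        using \<open>norm h \<le> 1\<close> r(1)[of n] by (simp add: \<eta>_def dist_norm mult_left_le)
      then have "J \<gamma> - \<epsilon>/2 * r n \<le> J \<gamma> - \<epsilon>/2 * dist \<gamma> \<eta>"
        using \<open>\<epsilon> > 0\<close> by simp
      also have "\<dots> \<le> J \<eta>" by (rule ekeland) fact
      also have "\<dots> \<le> \<Phi> (\<gamma> s + r n *\<^sub>R h s)" using s(2) by (simp add: \<eta>_def)
      finally show ?thesis using s(1) by blast
    qed
    then obtain s where s: "\<And>n. s n \<in> {0..1}"
      "\<And>n. J \<gamma> - \<epsilon>/2 * r n \<le> \<Phi> (\<gamma> (s n) + r n *\<^sub>R h (s n))" by metis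
    obtain t where t: "t \<in> {0..1}" "\<Phi> (\<gamma> t) = J \<gamma>"
      "\<And>q. q > 0 \<Longrightarrow> I' (\<gamma> t) (h t) - \<epsilon>/2 \<le> (I0 (\<gamma> t + q *\<^sub>R h t) - I0 (\<gamma> t)) / q"
    proof (rule limit_of_perturbed_peaks[OF conv I0_cont C1, of "{0..1}" \<gamma> h r s "J \<gamma>" "\<epsilon>/2"])
      show "norm (h t) \<le> 1" for t
        using norm_bounded[of h t] \<open>norm h \<le> 1\<close> by simp
      show "I0 (\<gamma> t) - I (\<gamma> t) \<le> J \<gamma>" if "t \<in> {0..1}" for t
        using \<Phi>_le_J[of \<gamma> t] that by (simp add: \<Phi>)
    qed (use r s in \<open>auto simp: \<Phi>\<close>)
    have "t \<in> {0..1} \<inter> K" using t by (simp add: K_def)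
    from h0(4)[OF this] obtain q where "q > 0"
      "(I0 (\<gamma> t + q *\<^sub>R h t) - I0 (\<gamma> t)) / q < I' (\<gamma> t) (h t) - \<epsilon>"
      unfolding h[OF t(1)] by blast
    with t(3)[of q] \<open>\<epsilon> > 0\<close> show False by simp
  qed
  ultimately show ?thesis using \<open>\<alpha> \<le> c\<close> by blast
qed

end
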